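(* Let $a\ge 3$ and $d\ge a(2^{12}-1)$ be integers. Then \[ q_d^{(a)}(n)\ \ge\ Q_d^{(a)}(n) \] holds for all non-negative integers $n$, except for: (1) $n=d-a+3$, $n=d+3$, or $n=d+a+3$, when $d+3$ is a multiple of $a$; (2) $n=d+a+3$, when $d+3$ is not a multiple of $a$ and $a>3$. (That is, the inequality holds for every integer $n\ge 0$ that is not one of the exceptional values listed for the given pair $(a,d)$; in particular there are no exceptional values when $a=3$ and $3\nmid d+3$.)
   Context: A partition of a positive integer $n$ is an unordered tuple (multiset) $(\pi_1,\dots,\pi_k)$ of positive integers, called its parts, with $\pi_1+\cdots+\pi_k=n$; the integer $0$ has exactly one partition, the empty one, which satisfies every condition on parts. For positive integers $a,b,d$ and an integer $n\ge 0$: $q_d^{(a)}(n)$ denotes the number of partitions of $n$ in which every part is $\ge a$ and any two parts (at different positions of the tuple) differ by at least $d$; $Q_d^{(b)}(n)$ denotes the number of partitions of $n$ in which every part is congruent to $b$ or to $-b$ modulo $d+3$ (repeated parts allowed). *)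

theory Defs
  imports "HOL-Library.Multiset" "HOL-Number_Theory.Cong"
begin

definition partitions :: "nat \<Rightarrow> nat multiset set" where
  "partitions n = {p. 0 \<notin># p \<and> sum_mset p = n}"

text \<open>Two parts at different positions of the tuple \<open>p\<close> are a part \<open>x\<close> together with a part
  \<open>y\<close> of \<open>p - {#x#}\<close>; in particular equal parts are compared with each other.\<close>

definition diff_ge :: "nat \<Rightarrow> nat multiset \<Rightarrow> bool" where
  "diff_ge d p \<longleftrightarrow> (\<forall>x \<in># p. \<forall>y \<in># p - {#x#}. \<bar>int x - int y\<bar> \<ge> int d)"

definition q :: "nat \<Rightarrow> nat \<Rightarrow> nat \<Rightarrow> nat" where
  "q d a n = card {p \<in> partitions n. (\<forall>x \<in># p. x \<ge> a) \<and> diff_ge d p}"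

definition Q :: "nat \<Rightarrow> nat \<Rightarrow> nat \<Rightarrow> nat" where
  "Q d b n = card {p \<in> partitions n.
     \<forall>x \<in># p. [int x = int b] (mod int (d + 3)) \<or> [int x = - int b] (mod int (d + 3))}"

text \<open>The sets counted by \<^term>\<open>q\<close> and \<^term>\<open>Q\<close> are finite.\<close>

lemma finite_partitions: "finite (partitions n)"
proof (rule finite_subset)
  show "partitions n \<subseteq> mset ` {xs. set xs \<subseteq> {..n} \<and> length xs \<le> n}"
  proof
    fix p assume "p \<in> partitions n"
    then have p: "0 \<notin># p" "sum_mset p = n" by (auto simp: partitions_def)
    obtain xs where xs: "mset xs = p" using ex_mset by blast
    have s: "sum_list xs = n" using p xs by (metis sum_mset_sum_list)
    have "length xs \<le> sum_list xs" using p(1) unfolding xs[symmetric]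
      by (induction xs) auto
    moreover have "x \<le> n" if "x \<in> set xs" for x using s that member_le_sum_list by blast
    ultimately show "p \<in> mset ` {xs. set xs \<subseteq> {..n} \<and> length xs \<le> n}"
      using xs s by auto
  qed
  show "finite (mset ` {xs. set xs \<subseteq> {..n} \<and> length xs \<le> n})"
    by (intro finite_imageI finite_lists_length_le) auto
qed

end

theory Submission
  imports Defs Complex_Main
begin

text \<open>
  Put \<open>m = d + 3\<close> and \<open>c = n div (m - a)\<close>. Since \<open>d\<close> is huge compared with \<open>a\<close>, crude bounds suffice
  as soon as \<open>c \<ge> 2\<close>. A partition counted by \<open>Q d a n\<close> is determined by its parts other than \<open>a\<close>;
  these are \<open>i * m \<plusminus> a\<close> with \<open>i \<ge> 1\<close>, and their multipliers \<open>i\<close> add up to at most \<open>c\<close>. Bounding the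
  coefficients of the generating function by its value at \<open>x = u / (u + 1)\<close> gives
  \<open>Q d a n \<le> (1 + 1 / u) ^ c * exp (4 * u)\<close>, which is about \<open>exp (5 * sqrt c)\<close> for \<open>u\<close> near \<open>sqrt c\<close>.
  On the other side, take \<open>j + 1\<close> parts with \<open>j\<close> near \<open>sqrt c\<close>: the smallest part and all gaps but the
  last one can exceed their minimal values independently by \<open>0, \<dots>, M\<close>, where \<open>M\<close> is of the order
  of \<open>d\<close>, so \<open>q d a n \<ge> (M + 1) ^ j\<close>. For \<open>c < 2\<close> at most one part differs from \<open>a\<close>, hence
  \<open>Q d a n \<le> 3\<close>, and divisibility by \<open>a\<close> isolates the exceptional values of \<open>n\<close>.
\<close>

section \<open>Generating function estimates\<close>

lemma sum_inverse_squares_le: "(\<Sum>r\<le>n. 1 / (real r + 1)\<^sup>2) \<le> 2 - 1 / (real n + 1)"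
proof (induction n)
  case (Suc n)
  have "1 / (real n + 2)\<^sup>2 \<le> 1 / ((real n + 1) * (real n + 2))"
    unfolding power2_eq_square by (intro divide_left_mono mult_right_mono mult_pos_pos) auto
  also have "\<dots> = 1 / (real n + 1) - 1 / (real n + 2)" by (simp add: divide_simps)
  finally show ?case using Suc by (simp add: add.commute)
qed simp

lemma ln_one_minus_sums:
  fixes y :: real
  assumes "0 < y" "y < 1"
  shows "(\<lambda>r. y ^ Suc r / (real r + 1)) sums (- ln (1 - y))"
proof -
  have "summable (\<lambda>r. y ^ Suc r / (real r + 1))"
  proof (rule summable_comparison_test')
    show "summable (\<lambda>r. y ^ Suc r)" using assms by simp
    fix r show "norm (y ^ Suc r / (real r + 1)) \<le> y ^ Suc r"
      using assms by (simp add: divide_le_eq mult_left_mono)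
  qed
  moreover have "ln (1 - y) = (\<Sum>r. - (y ^ Suc r / (real r + 1)))"
  proof -
    have "(- 1) ^ r * (1 / real (r + 1)) * (1 - y - 1) ^ Suc r = - (y ^ Suc r / (real r + 1))" for r
      by (simp add: power_minus[of y] add.commute)
    then show ?thesis using ln_series[of "1 - y"] assms by simp
  qed
  ultimately show ?thesis
    by (simp add: suminf_minus summable_sums)
qed

text \<open>Taking logarithms and exchanging the sums leaves geometric sums in \<open>i\<close> with
  ratio \<open>y = x ^ Suc r\<close>. Each is at most \<open>x / (1 - x) / (r + 1)\<close>, so the
  \<open>r\<close>-th term is of order \<open>1 / (r + 1)^2\<close>, and the inverse squares sum to
  at most 2.\<close>

lemma prod_one_minus_powers_le:
  fixes x :: real
  assumes x: "0 < x" "x < 1"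
  shows "(\<Prod>i=1..N. 1 / (1 - x ^ i)) \<le> exp (2 * (x / (1 - x)))"
proof -
  have pw: "0 < x ^ i" "x ^ i < 1" if "i \<in> {1..N}" for i
    using x that by (auto intro: power_Suc_less_one power_less_one_iff[THEN iffD2])
  define T where "T r = (\<Sum>i=1..N. (x ^ i) ^ Suc r / (real r + 1))" for r
  have T: "T sums (\<Sum>i=1..N. - ln (1 - x ^ i))"
    unfolding T_def by (intro sums_sum ln_one_minus_sums pw)
  have T_le: "T r \<le> x / (1 - x) * (1 / (real r + 1)\<^sup>2)" for r
  proof -
    define y where "y = x ^ Suc r"
    have y: "0 < y" "y < 1" using x unfolding y_def by (auto intro: power_Suc_less_one simp del: power_Suc)
    have "(\<Sum>i=1..N. y ^ i) * (1 - y) = y - y ^ Suc N"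
    proof (induction N)
      case (Suc N)
      have "(\<Sum>i=1..Suc N. y ^ i) * (1 - y) = (\<Sum>i=1..N. y ^ i) * (1 - y) + y ^ Suc N * (1 - y)"
        by (simp add: distrib_right)
      also have "(\<Sum>i=1..N. y ^ i) * (1 - y) = y - y ^ Suc N" by (rule Suc)
      also have "y - y ^ Suc N + y ^ Suc N * (1 - y) = y - y ^ Suc (Suc N)"
        by (simp add: algebra_simps)
      finally show ?case .
    qed simp
    then have "(\<Sum>i=1..N. y ^ i) * (1 - y) \<le> y" using y by simp
    then have "(\<Sum>i=1..N. y ^ i) \<le> y / (1 - y)" using y by (simp add: pos_le_divide_eq)
    \<comment> \<open>Here \<open>1 - y\<close> is \<open>1 - x\<close> times a sum of
      \<open>r + 1\<close> powers of \<open>x\<close>, each at least \<open>x ^ r\<close>.\<close>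
    also have "y / (1 - y) \<le> x / (1 - x) / (real r + 1)"
    proof -
      have "(\<Sum>l<Suc r. x ^ r) \<le> (\<Sum>l<Suc r. x ^ l)"
        using x by (intro sum_mono power_decreasing) auto
      then have "(real r + 1) * x ^ r * (1 - x) \<le> (\<Sum>l<Suc r. x ^ l) * (1 - x)"
        using x by (intro mult_right_mono) (auto simp: algebra_simps)
      also have "\<dots> = 1 - y"
        using one_diff_power_eq[of x "Suc r"] by (simp add: y_def mult.commute)
      finally have "x * ((real r + 1) * x ^ r * (1 - x)) \<le> x * (1 - y)"
        using x by (intro mult_left_mono) auto
      then have "y * ((1 - x) * (real r + 1)) \<le> x * (1 - y)"
        by (simp add: y_def algebra_simps)
      moreover have "(1 - x) * (real r + 1) > 0" using x by (intro mult_pos_pos) auto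
      ultimately show ?thesis using x y by (simp add: divide_simps) 
    qed
    finally have "(\<Sum>i=1..N. y ^ i) / (real r + 1) \<le> x / (1 - x) / (real r + 1) / (real r + 1)"
      by (intro divide_right_mono) auto
    moreover have "T r = (\<Sum>i=1..N. y ^ i) / (real r + 1)"
      unfolding T_def y_def sum_divide_distrib
      by (intro sum.cong refl arg_cong2[of _ _ _ _ "(/)"]) (metis power_mult mult.commute)
    ultimately show ?thesis by (simp add: power2_eq_square mult.assoc)
  qed
  have "(\<Sum>i=1..N. - ln (1 - x ^ i)) \<le> 2 * (x / (1 - x))"
  proof (rule LIMSEQ_le_const2[OF T[unfolded sums_def_le]], intro exI allI impI)
    fix n :: nat
    have "(\<Sum>r\<le>n. T r) \<le> x / (1 - x) * (\<Sum>r\<le>n. 1 / (real r + 1)\<^sup>2)"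
      unfolding sum_distrib_left by (intro sum_mono T_le)
    also have "\<dots> \<le> x / (1 - x) * 2"
      using x sum_inverse_squares_le[of n]
      by (intro mult_left_mono) (auto intro: order_trans)
    finally show "(\<Sum>r\<le>n. T r) \<le> 2 * (x / (1 - x))" by (simp add: mult.commute)
  qed
  also have "(\<Sum>i=1..N. - ln (1 - x ^ i)) = ln (\<Prod>i=1..N. 1 / (1 - x ^ i))"
  proof -
    have "ln (\<Prod>i=1..N. 1 / (1 - x ^ i)) = (\<Sum>i=1..N. ln (1 / (1 - x ^ i)))"
      by (rule ln_prod) (use pw in force)+
    also have "\<dots> = (\<Sum>i=1..N. - ln (1 - x ^ i))"
      by (rule sum.cong) (use pw in \<open>force simp: ln_div\<close>)+
    finally show ?thesis ..
  qed
  finally have "exp (ln (\<Prod>i=1..N. 1 / (1 - x ^ i))) \<le> exp (2 * (x / (1 - x)))"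
    by (simp only: exp_le_cancel_iff)
  moreover have "0 < (\<Prod>i=1..N. 1 / (1 - x ^ i))"
    by (rule prod_pos) (use pw in force)
  ultimately show ?thesis by (simp only: exp_ln)
qed

text \<open>A multiset over \<open>insert s S\<close> either avoids \<open>s\<close> or loses one
  copy of it, which lowers the weight by \<open>w s\<close> but may leave further copies. Hence the
  inner induction on \<open>c\<close>; it closes because \<open>R / (1 - t)\<close> solves
  \<open>X = R + t * X\<close> for \<open>t = x ^ w s\<close>.\<close>

lemma card_weighted_multisets_le:
  fixes w :: "'a \<Rightarrow> nat" and x :: real
  assumes "finite S" "\<And>s. s \<in> S \<Longrightarrow> w s > 0" "0 < x" "x < 1"
  shows "finite {p. set_mset p \<subseteq> S \<and> (\<Sum>s\<in>#p. w s) \<le> c} \<and>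
    real (card {p. set_mset p \<subseteq> S \<and> (\<Sum>s\<in>#p. w s) \<le> c}) * x ^ c \<le> (\<Prod>s\<in>S. 1 / (1 - x ^ w s))"
  using assms(1,2)
proof (induction S arbitrary: c rule: finite_induct)
  case empty
  have "{p. set_mset p \<subseteq> {} \<and> (\<Sum>s\<in>#p. w s) \<le> c} = {{#}}" by auto
  then show ?case using assms by (simp add: power_le_one)
next
  case (insert s S)
  let ?F = "\<lambda>S c. {p. set_mset p \<subseteq> S \<and> (\<Sum>s\<in>#p. w s) \<le> c}"
  define R where "R = (\<Prod>s\<in>S. 1 / (1 - x ^ w s))"
  have IH: "finite (?F S c)" "real (card (?F S c)) * x ^ c \<le> R" for c
    using insert by (auto simp: R_def)
  have ws: "w s > 0" using insert by auto
  then have xw: "0 < x ^ w s" "x ^ w s < 1" using assms by (auto simp: power_less_one_iff)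
  have R: "(\<Prod>s\<in>insert s S. 1 / (1 - x ^ w s)) = R / (1 - x ^ w s)"
    using insert by (simp add: R_def)
  have R0: "0 \<le> R" using order_trans[OF _ IH(2)[of 0]] by simp
  show ?case unfolding R
  proof (induction c rule: less_induct)
    case (less c)
    have split: "?F (insert s S) c \<subseteq> ?F S c \<union> (if w s \<le> c then add_mset s ` ?F (insert s S) (c - w s) else {})"
    proof
      fix p assume p: "p \<in> ?F (insert s S) c"
      show "p \<in> ?F S c \<union> (if w s \<le> c then add_mset s ` ?F (insert s S) (c - w s) else {})"
      proof (cases "s \<in># p")
        case True
        then obtain p' where "p = add_mset s p'" by (metis mset_add)
        then show ?thesis using p by auto
      next
        case False then show ?thesis using p by auto
      qed
    qed
    show ?case
    proof (cases "w s \<le> c")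
      case True
      have IH': "finite (?F (insert s S) (c - w s))"
        "real (card (?F (insert s S) (c - w s))) * x ^ (c - w s) \<le> R / (1 - x ^ w s)"
        using less[of "c - w s"] ws True by auto
      have sub: "?F (insert s S) c \<subseteq> ?F S c \<union> add_mset s ` ?F (insert s S) (c - w s)"
        using split True by simp
      have fin: "finite (?F S c \<union> add_mset s ` ?F (insert s S) (c - w s))"
        using IH(1) IH'(1) by blast
      have "card (?F (insert s S) c) \<le> card (?F S c) + card (?F (insert s S) (c - w s))"
        using card_mono[OF fin sub] card_Un_le[of "?F S c" "add_mset s ` ?F (insert s S) (c - w s)"]
          card_image_le[OF IH'(1), of "add_mset s"] by linarith
      then have "real (card (?F (insert s S) c)) * x ^ c
          \<le> (real (card (?F S c)) + real (card (?F (insert s S) (c - w s)))) * x ^ c"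
        using assms(3) by (intro mult_right_mono zero_le_power) (simp_all flip: of_nat_add)
      also have "\<dots> = real (card (?F S c)) * x ^ c
          + x ^ w s * (real (card (?F (insert s S) (c - w s))) * x ^ (c - w s))"
        using True by (simp add: algebra_simps flip: power_add)
      also have "\<dots> \<le> R + x ^ w s * (R / (1 - x ^ w s))"
        using IH IH' xw by (intro add_mono mult_left_mono) auto
      also have "\<dots> = R / (1 - x ^ w s)" using xw by (simp add: field_simps)
      finally show ?thesis using finite_subset[OF sub fin] by blast
    next
      case False
      then have sub: "?F (insert s S) c \<subseteq> ?F S c" using split by simp
      have "real (card (?F (insert s S) c)) * x ^ c \<le> real (card (?F S c)) * x ^ c"
        using assms card_mono[OF IH(1) sub] by (intro mult_right_mono) auto
      also have "\<dots> \<le> R" by (rule IH)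
      also have "R \<le> R / (1 - x ^ w s)" using R0 xw by (simp add: field_simps)
      finally show ?thesis using finite_subset[OF sub IH(1)] by blast
    qed
  qed
qed

section \<open>Lower bounds for \<open>q\<close>\<close>

text \<open>The summand for \<open>e\<close> counts the partitions whose smallest part is \<open>a + e\<close>.\<close>

lemma q_ge_sum:
  assumes "0 < a" "0 < d" "a + M \<le> n"
  shows "(\<Sum>e\<le>M. q d (a + e + d) (n - a - e)) \<le> q d a n"
proof -
  let ?S = "\<lambda>a n. {p \<in> partitions n. (\<forall>x \<in># p. x \<ge> a) \<and> diff_ge d p}"
  let ?I = "\<lambda>e. add_mset (a + e) ` ?S (a + e + d) (n - a - e)"
  have fin: "finite (?S b k)" for b k using finite_partitions[of k] by simp
  have "(\<Sum>e\<le>M. q d (a + e + d) (n - a - e)) = (\<Sum>e\<le>M. card (?I e))"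
    unfolding q_def by (intro sum.cong refl card_image[symmetric]) (auto simp: inj_on_def)
  also have "\<dots> = card (\<Union>e\<le>M. ?I e)"
  proof (rule card_UN_disjoint[symmetric])
    show "\<forall>e\<in>{..M}. \<forall>e'\<in>{..M}. e \<noteq> e' \<longrightarrow> ?I e \<inter> ?I e' = {}"
    proof (intro ballI impI)
      have *: "?I e \<inter> ?I e' = {}" if "e < e'" for e e' :: nat
      proof -
        have False if "p \<in> ?I e" "p \<in> ?I e'" for p
        proof -
          have "a + e \<in># p" using that(1) by auto
          moreover have "\<forall>x\<in>#p. a + e' \<le> x" using that(2) by fastforce
          ultimately show False using \<open>e < e'\<close> by auto
        qed
        then show ?thesis by blast
      qed
      fix e e' :: nat assume "e \<noteq> e'"
      then show "?I e \<inter> ?I e' = {}" using *[of e e'] *[of e' e] by (metis Int_commute nat_neq_iff)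
    qed
  qed (use fin in auto)
  also have "\<dots> \<le> card (?S a n)"
  proof (rule card_mono[OF fin], safe)
    fix e p assume *: "e \<le> M" "p \<in> partitions (n - a - e)" "\<forall>x\<in>#p. a + e + d \<le> x" "diff_ge d p"
    show "add_mset (a + e) p \<in> partitions n"
      using * assms by (auto simp: partitions_def)
    show "x \<ge> a" if "x \<in># add_mset (a + e) p" for x
      using * that by force
    show "diff_ge d (add_mset (a + e) p)"
      unfolding diff_ge_def
    proof (intro ballI)
      fix x y assume x: "x \<in># add_mset (a + e) p" and y: "y \<in># add_mset (a + e) p - {#x#}"
      show "int d \<le> \<bar>int x - int y\<bar>"
      proof (cases "x = a + e")
        case True
        then have "y \<in># p" using y by simp
        then show ?thesis using * True by fastforce
      next
        case False
        then have xp: "x \<in># p" using x by simp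
        then have "y = a + e \<or> y \<in># p - {#x#}" using y by (auto simp: False split: if_splits)
        then show ?thesis
        proof
          assume "y = a + e" then show ?thesis using * xp by fastforce
        next
          assume "y \<in># p - {#x#}" then show ?thesis using * xp by (auto simp: diff_ge_def)
        qed
      qed
    qed
  qed
  finally show ?thesis unfolding q_def .
qed

lemma q_pos:
  assumes "0 < a" "n = 0 \<or> a \<le> n"
  shows "1 \<le> q d a n"
proof -
  let ?S = "{p \<in> partitions n. (\<forall>x \<in># p. x \<ge> a) \<and> diff_ge d p}"
  have "(if n = 0 then {#} else {#n#}) \<in> ?S" using assms by (auto simp: partitions_def diff_ge_def)
  moreover have "finite ?S" using finite_partitions[of n] by simp
  ultimately have "0 < card ?S" unfolding card_gt_0_iff by blast
  then show ?thesis unfolding q_def by simp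
qed

text \<open>Besides the single part \<open>n\<close>, there are the pairs with smaller part
  \<open>a + e\<close>; the bound on \<open>n\<close> keeps their gap at least \<open>d\<close> for
  all \<open>e \<le> M\<close>.\<close>

lemma q_ge_two_parts:
  assumes "0 < a" "0 < d" "d + 2 * a + 2 * M \<le> n"
  shows "M + 2 \<le> q d a n"
proof -
  let ?S = "{p \<in> partitions n. (\<forall>x \<in># p. x \<ge> a) \<and> diff_ge d p}"
  let ?f = "\<lambda>e. {#a + e, n - (a + e)#}"
  have "inj_on ?f {..M}"
    using assms by (auto simp: inj_on_def add_eq_conv_diff split: if_splits)
  then have "card (insert {#n#} (?f ` {..M})) = M + 2"
    by (subst card_insert_disjoint) (auto simp: card_image)
  moreover have "insert {#n#} (?f ` {..M}) \<subseteq> ?S"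
    using assms by (auto simp: partitions_def diff_ge_def)
  moreover have "finite ?S" using finite_partitions[of n] by simp
  ultimately show ?thesis unfolding q_def using card_mono[of ?S "insert {#n#} (?f ` {..M})"] by linarith
qed

text \<open>The hypothesis is doubled to avoid halves. The minimal parts
  \<open>a, a + d, ..., a + j * d\<close> account for the first two terms. The \<open>j\<close> free
  excesses are carried by \<open>j + 1, j, ..., 2\<close> parts, at a cost of at most
  \<open>M * (j * (j + 3)) / 2\<close>; the largest part absorbs the remainder.\<close>

lemma q_ge_power:
  assumes "0 < a" "0 < d" "2 * (j + 1) * a + d * (j * (j + 1)) + M * (j * (j + 3)) \<le> 2 * n"
  shows "(M + 1) ^ j \<le> q d a n"
  using assms(1,3)
proof (induction j arbitrary: a n)
  case 0
  then show ?case using q_pos by simp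
next
  case (Suc j)
  have aM: "a + M \<le> n"
  proof -
    have "2 * (a + M) \<le> 2 * (Suc j + 1) * a + M * (Suc j * (Suc j + 3))"
      by (simp add: algebra_simps)
    also have "\<dots> \<le> 2 * n" using Suc.prems(2) by (rule order_trans[rotated]) simp
    finally show ?thesis by simp
  qed
  have "(M + 1) ^ j \<le> q d (a + e + d) (n - a - e)" if "e \<le> M" for e
  proof (rule Suc.IH)
    \<comment> \<open>The excess \<open>e\<close> is carried by all \<open>j + 2\<close> parts, and
      \<open>(j + 1) * (j + 4) - j * (j + 3) = 2 * (j + 2)\<close> is the allowance for it.\<close>
    have "2 * (j + 2) * e \<le> 2 * (j + 2) * M" using that by (intro mult_left_mono) auto
    then show "2 * (j + 1) * (a + e + d) + d * (j * (j + 1)) + M * (j * (j + 3)) \<le> 2 * (n - a - e)"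
      using Suc.prems that aM by (simp add: algebra_simps)
  qed (use Suc.prems in simp)
  then have "(\<Sum>e\<le>M. (M + 1) ^ j) \<le> (\<Sum>e\<le>M. q d (a + e + d) (n - a - e))"
    by (intro sum_mono) auto
  also have "\<dots> \<le> q d a n" using Suc.prems assms aM by (intro q_ge_sum) auto
  finally show ?case by simp
qed

section \<open>Upper bounds for \<open>Q\<close>\<close>

lemma finite_multisets_sum_le:
  fixes B :: "nat set"
  assumes "0 \<notin> B"
  shows "finite {r. set_mset r \<subseteq> B \<and> sum_mset r \<le> n}"
proof (rule finite_subset)
  show "{r. set_mset r \<subseteq> B \<and> sum_mset r \<le> n} \<subseteq> (\<Union>k\<le>n. partitions k)"
    using assms by (auto simp: partitions_def)
qed (simp add: finite_partitions)

text \<open>The residues \<open>\<plusminus> a\<close> modulo \<open>m\<close> without \<open>a\<close> itself, which is the case \<open>i = 0\<close>. The equation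
  \<open>b + a = i * m\<close> avoids truncated subtraction.\<close>

definition big_parts :: "nat \<Rightarrow> nat \<Rightarrow> nat set" where
  "big_parts m a = {b. \<exists>i\<ge>1. b + a = i * m \<or> b = i * m + a}"

lemma big_parts_ge:
  assumes "b \<in> big_parts m a" "a < m"
  shows "m - a \<le> b"
proof -
  obtain i where i: "i \<ge> 1" "b + a = i * m \<or> b = i * m + a"
    using assms by (auto simp: big_parts_def)
  then have "1 * m \<le> i * m" by (intro mult_right_mono) auto
  then show ?thesis using i by linarith
qed

text \<open>Deleting all copies of \<open>a\<close> is injective, since \<open>n\<close> determines
  their number. The divisibility condition, irrelevant to the exponential bound, is what settles
  small \<open>n\<close>.\<close>

lemma Q_le_card_big_parts:
  assumes "0 < a" "a < d + 3"
  shows "Q d a n \<le> card {r. set_mset r \<subseteq> big_parts (d + 3) a \<and> sum_mset r \<le> n \<and> a dvd n - sum_mset r}"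
    (is "_ \<le> card ?R")
  unfolding Q_def
proof (rule card_inj_on_le)
  let ?P = "{p \<in> partitions n.
     \<forall>x \<in># p. [int x = int a] (mod int (d + 3)) \<or> [int x = - int a] (mod int (d + 3))}"
  have split: "p = filter_mset (\<lambda>x. x \<noteq> a) p + replicate_mset (count p a) a" for p
    by (rule multiset_eqI) auto
  have sum: "sum_mset p = sum_mset (filter_mset (\<lambda>x. x \<noteq> a) p) + count p a * a" for p
    by (subst split) (simp only: sum_mset.union sum_mset_replicate_mset, simp)
  show "inj_on (filter_mset (\<lambda>x. x \<noteq> a)) ?P"
  proof (rule inj_onI)
    fix p p' assume *: "p \<in> ?P" "p' \<in> ?P" "{#x \<in># p. x \<noteq> a#} = {#x \<in># p'. x \<noteq> a#}"
    then have "sum_mset p = sum_mset p'" by (simp add: partitions_def)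
    then have "count p a = count p' a" using sum[of p] sum[of p'] * assms by simp
    then show "p = p'" using split[of p] split[of p'] * by metis
  qed
  show "filter_mset (\<lambda>x. x \<noteq> a) ` ?P \<subseteq> ?R"
  proof safe
    fix p assume p: "p \<in> partitions n"
      "\<forall>x\<in>#p. [int x = int a] (mod int (d + 3)) \<or> [int x = - int a] (mod int (d + 3))"
    have n: "n = sum_mset (filter_mset (\<lambda>x. x \<noteq> a) p) + count p a * a"
      using p sum[of p] by (simp add: partitions_def)
    show "sum_mset (filter_mset (\<lambda>x. x \<noteq> a) p) \<le> n" using n by linarith
    have "n - sum_mset (filter_mset (\<lambda>x. x \<noteq> a) p) = count p a * a" using n by linarith
    then show "a dvd n - sum_mset (filter_mset (\<lambda>x. x \<noteq> a) p)" by simp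
    fix x assume "x \<in># filter_mset (\<lambda>x. x \<noteq> a) p"
    then have x: "x \<in># p" "x \<noteq> a" by auto
    then have "x > 0" using p by (auto simp: partitions_def intro: gr0I)
    consider "[int x = int a] (mod int (d + 3))" | "[int x = - int a] (mod int (d + 3))"
      using p x by blast
    then show "x \<in> big_parts (d + 3) a"
    proof cases
      case 1
      then obtain t where t: "int x = int a + t * int (d + 3)"
        by (metis cong_iff_lin cong_sym mult.commute)
      have "t > 0"
      proof (rule ccontr)
        assume "\<not> t > 0"
        moreover have "t \<noteq> 0" using t x by auto
        ultimately have tm: "t * int (d + 3) \<le> (-1) * int (d + 3)" by (intro mult_right_mono) auto
        have "int a < int (d + 3)" using assms by simp
        moreover have "int x \<le> int a + (-1) * int (d + 3)"
          unfolding t by (intro add_left_mono tm)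
        ultimately have "int x < 0" by simp
        then show False by simp
      qed
      moreover have "x = nat t * (d + 3) + a"
      proof -
        have "int x = int (nat t * (d + 3) + a)" using t calculation by simp
        then show ?thesis by (simp only: of_nat_eq_iff)
      qed
      ultimately show ?thesis unfolding big_parts_def by (intro CollectI exI[of _ "nat t"]) auto
    next
      case 2
      then obtain t where t: "int x = - int a + t * int (d + 3)"
        by (metis cong_iff_lin cong_sym mult.commute)
      have "t > 0"
      proof (rule ccontr)
        assume "\<not> t > 0"
        then have "t * int (d + 3) \<le> 0 * int (d + 3)" by (intro mult_right_mono) auto
        then show False using t \<open>x > 0\<close> by linarith
      qed
      moreover have "x + a = nat t * (d + 3)"
      proof -
        have "int (x + a) = int (nat t * (d + 3))" using t calculation by simp
        then show ?thesis by (simp only: of_nat_eq_iff)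
      qed
      ultimately show ?thesis unfolding big_parts_def by (intro CollectI exI[of _ "nat t"]) auto
    qed
  qed
  have "0 \<notin> big_parts (d + 3) a" using big_parts_ge[of 0 "d + 3" a] assms by auto
  then show "finite ?R"     by (intro finite_subset[OF _ finite_multisets_sum_le[of "big_parts (d + 3) a" n]]) auto
qed

lemma Q_le_exp:
  fixes u :: real
  assumes "0 < a" "2 * a < d + 3" "n < (c + 1) * (d + 3 - a)" "0 < u"
  shows "real (Q d a n) \<le> (1 + 1 / u) ^ c * exp (4 * u)"
proof -
  define m where "m = d + 3"
  \<comment> \<open>Chosen so that \<open>x / (1 - x) = u\<close>.\<close>
  define x where "x = u / (u + 1)"
  have x: "0 < x" "x < 1" and xu: "x / (1 - x) = u" and x_inv: "1 / x = 1 + 1 / u"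
    using assms by (auto simp: x_def field_simps)
  \<comment> \<open>Recovers the multiplier \<open>i\<close> from both \<open>i * m - a\<close> and
    \<open>i * m + a\<close>; the latter needs \<open>2 * a < m\<close>.\<close>
  define w where "w b = (b + a) div m" for b
  define S where "S = {b \<in> big_parts m a. b \<le> n}"
  define f where "f i = i * m - a" for i
  define g where "g i = i * m + a" for i
  have m: "2 * a < m" "a < m" using assms by (auto simp: m_def)
  have f: "f i + a = i * m" if "i \<ge> 1" for i
  proof -
    have "1 * m \<le> i * m" using that by (intro mult_right_mono) auto
    then show ?thesis using m unfolding f_def by linarith
  qed
  have wf: "w (f i) = i" if "i \<ge> 1" for i using f[OF that] m by (simp add: w_def)
  have wg: "w (g i) = i" for i
    using m div_mult_self3[of m i "2 * a"] by (simp add: w_def g_def mult_2 add.assoc)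
  have big: "\<exists>i\<ge>1. b = f i \<or> b = g i" if b: "b \<in> big_parts m a" for b
  proof -
    obtain i where "i \<ge> 1" "b + a = i * m \<or> b = i * m + a" using b by (auto simp: big_parts_def)
    then show ?thesis using f[of i] by (auto simp: g_def intro!: exI[of _ i])
  qed
  have w_pos: "w b \<ge> 1" if "b \<in> big_parts m a" for b
    using big[OF that] wf wg by auto
  \<comment> \<open>This turns the bound \<open>n\<close> on the sum of the parts into the bound
    \<open>c\<close> on the sum of their weights.\<close>
  have w_le: "(m - a) * w b \<le> b" if b: "b \<in> big_parts m a" for b
  proof -
    obtain i where i: "i \<ge> 1" "b = f i \<or> b = g i" using big[OF b] by blast
    have "1 * a \<le> i * a" using i by (intro mult_right_mono) auto
    moreover have "(m - a) * i = i * m - i * a" by (simp add: diff_mult_distrib2 mult.commute)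
    ultimately have "(m - a) * i \<le> f i" unfolding f_def by linarith
    moreover have "f i \<le> g i" by (simp add: f_def g_def)
    ultimately show ?thesis using i wf wg by auto
  qed
  have w_c: "w b \<le> c" if "b \<in> S" for b
  proof -
    have "(m - a) * w b < (m - a) * (c + 1)"
      using w_le[of b] that assms by (simp add: S_def m_def mult.commute)
    then have "w b < c + 1" by (simp only: mult_less_cancel1)
    then show ?thesis by simp
  qed
  have S_sub: "S \<subseteq> f ` {1..c} \<union> g ` {1..c}"
  proof
    fix b assume b: "b \<in> S"
    then obtain i where "i \<ge> 1" "b = f i \<or> b = g i" using big[of b] by (auto simp: S_def)
    moreover have "w b \<le> c" using w_c b .
    ultimately show "b \<in> f ` {1..c} \<union> g ` {1..c}" using wf wg by auto
  qed
  have finS: "finite S" using finite_subset[OF S_sub] by simp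
  have disj: "f ` {1..c} \<inter> g ` {1..c} = {}"
  proof -
    have False if "i \<ge> 1" "f i = g j" for i j
    proof -
      have "i = j" using wf[of i] wg[of j] that by simp
      then show False using f[of i] that assms by (simp add: g_def)
    qed
    then show ?thesis by fastforce
  qed
  have injf: "inj_on f {1..c}" by (rule inj_on_inverseI[of _ w]) (simp add: wf)
  have injg: "inj_on g {1..c}" by (rule inj_on_inverseI[of _ w]) (simp add: wg)
  let ?h = "\<lambda>i. 1 / (1 - x ^ i)"
  have h: "1 \<le> ?h i" if "i \<ge> 1" for i
    using x that by (simp add: power_less_one_iff)
  have P: "1 \<le> (\<Prod>i=1..c. ?h i)" by (rule prod_ge_1) (use h in auto)
  \<comment> \<open>All factors are at least 1, so \<open>S\<close> may be enlarged to contain both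
    parts of each weight up to \<open>c\<close>; the product then becomes a square.\<close>
  have "(\<Prod>b\<in>S. ?h (w b)) \<le> (\<Prod>b\<in>f ` {1..c} \<union> g ` {1..c}. ?h (w b))"
  proof (rule prod_mono2[OF _ S_sub])
    fix b assume "b \<in> f ` {1..c} \<union> g ` {1..c} - S"
    then have "w b \<ge> 1" using wf wg by auto
    then show "1 \<le> ?h (w b)" by (rule h)
  next
    fix b assume "b \<in> S"
    then have "w b \<ge> 1" using w_pos by (auto simp: S_def)
    then show "0 \<le> ?h (w b)" using h[of "w b"] by linarith
  qed simp
  also have "\<dots> = (\<Prod>i=1..c. ?h i) * (\<Prod>i=1..c. ?h i)"
  proof -
    have "(\<Prod>b\<in>f ` {1..c}. ?h (w b)) = (\<Prod>i=1..c. ?h i)"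
      by (subst prod.reindex[OF injf]) (auto intro!: prod.cong simp: wf)
    moreover have "(\<Prod>b\<in>g ` {1..c}. ?h (w b)) = (\<Prod>i=1..c. ?h i)"
      by (subst prod.reindex[OF injg]) (auto intro!: prod.cong simp: wg)
    ultimately show ?thesis by (subst prod.union_disjoint[OF _ _ disj]) simp_all
  qed
  also have "\<dots> \<le> exp (2 * u) * exp (2 * u)"
    using prod_one_minus_powers_le[OF x, of c] P unfolding xu by (intro mult_mono) auto
  also have "\<dots> = exp (4 * u)" by (simp flip: exp_add)
  finally have prod_le: "(\<Prod>b\<in>S. ?h (w b)) \<le> exp (4 * u)" .

  let ?F = "{p. set_mset p \<subseteq> S \<and> (\<Sum>s\<in>#p. w s) \<le> c}"
  have F: "finite ?F" "real (card ?F) * x ^ c \<le> exp (4 * u)"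
    using card_weighted_multisets_le[OF finS _ x, of w c] w_pos prod_le
    by (force simp: S_def)+
  have sub: "{r. set_mset r \<subseteq> big_parts m a \<and> sum_mset r \<le> n \<and> a dvd n - sum_mset r} \<subseteq> ?F"
  proof safe
    fix r assume r: "set_mset r \<subseteq> big_parts m a" "sum_mset r \<le> n"
    have "b \<le> n" if "b \<in># r" for b
      using r(2) by (subst (asm) insert_DiffM[OF that, symmetric]) simp
    then show "b \<in> S" if "b \<in># r" for b using r that by (auto simp: S_def)
    have "(m - a) * (\<Sum>s\<in>#r. w s) \<le> sum_mset r"
      using r(1) by (induction r) (auto simp: distrib_left intro!: add_mono w_le)
    then have "(m - a) * (\<Sum>s\<in>#r. w s) < (m - a) * (c + 1)"
      using r assms by (simp add: m_def mult.commute)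
    then have "(\<Sum>s\<in>#r. w s) < c + 1" by (simp only: mult_less_cancel1)
    then show "(\<Sum>s\<in>#r. w s) \<le> c" by simp
  qed
  have "Q d a n \<le> card ?F"
    using Q_le_card_big_parts[of a d n, folded m_def] card_mono[OF F(1) sub] m assms by linarith
  then have "real (Q d a n) * x ^ c \<le> exp (4 * u)"
    using F(2) x by (meson mult_right_mono of_nat_le_iff order_trans zero_le_power less_imp_le)
  then have "real (Q d a n) \<le> exp (4 * u) / x ^ c" using x by (simp add: pos_le_divide_eq)
  also have "\<dots> = (1 + 1 / u) ^ c * exp (4 * u)"
    unfolding x_inv[symmetric] by (simp add: power_divide)
  finally show ?thesis .
qed

section \<open>Comparison for \<open>c \<ge> 2\<close>\<close>

text \<open>The intervals between consecutive pronic numbers \<open>j * (j + 1)\<close> tile the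
  positive integers. The upper end serves to bound \<open>Q\<close>, the lower end to bound
  \<open>q\<close>.\<close>

lemma ex_between_pronic:
  fixes c :: nat
  assumes "1 \<le> c"
  shows "\<exists>j. j * j + j + 1 \<le> c \<and> c \<le> (j + 1) * (j + 2)"
  using assms
proof (induction c rule: dec_induct)
  case base
  show ?case by (rule exI[of _ 0]) simp
next
  case (step c)
  then obtain j where j: "j * j + j + 1 \<le> c" "c \<le> (j + 1) * (j + 2)" by blast
  show ?case
  proof (cases "c = (j + 1) * (j + 2)")
    case True
    then show ?thesis by (intro exI[of _ "j + 1"]) simp
  next
    case False
    then show ?thesis using j by (intro exI[of _ j]) simp
  qed
qed

lemma Q_le_q_of_2_le_div:
  assumes a: "3 \<le> a" and d: "4095 * a \<le> d" and n: "2 * (d + 3 - a) \<le> n"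
  shows "Q d a n \<le> q d a n"
proof -
  define c where "c = n div (d + 3 - a)"
  have D: "0 < d + 3 - a" using assms by simp
  have c2: "2 \<le> c" using n D by (simp add: c_def less_eq_div_iff_mult_less_eq)
  have c_le: "c * (d + 3 - a) \<le> n" by (simp add: c_def)
  have lt_c: "n < (c + 1) * (d + 3 - a)"
    by (rule div_less_iff_less_mult[OF D, THEN iffD1]) (simp add: c_def)
  have e1: "exp (real k) \<le> 3 ^ k" for k
  proof -
    have "exp (real k) = exp 1 ^ k" by (simp add: exp_of_nat_mult[of k 1, simplified])
    also have "\<dots> \<le> 3 ^ k" by (intro power_mono exp_le) auto
    finally show ?thesis .
  qed
  show ?thesis
  proof (cases "c \<le> 6")
    case True
    \<comment> \<open>For these \<open>c\<close>, \<open>u = 1\<close> and a single free excess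
      suffice: \<open>2 ^ 6 * 3 ^ 4 = 5184 = M + 1\<close>.\<close>
    have "real (Q d a n) \<le> (1 + 1 / 1) ^ c * exp (4 * 1)"
      using Q_le_exp[of a d n c 1] a d lt_c by simp
    also have "\<dots> \<le> 2 ^ 6 * 3 ^ 4"
      using e1[of 4] power_increasing[OF True, of "2 :: real"] by (intro mult_mono) auto
    finally have "real (Q d a n) \<le> real 5184" by simp
    then have "Q d a n \<le> (5183 + 1) ^ 1" by (simp only: of_nat_le_iff) simp
    also have "\<dots> \<le> q d a n" using a d n by (intro q_ge_power) auto
    finally show ?thesis .
  next
    case False
    obtain j where j: "j * j + j + 1 \<le> c" "c \<le> (j + 1) * (j + 2)"
      using ex_between_pronic[of c] c2 by auto
    have j2: "2 \<le> j"
    proof (rule ccontr)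
      assume "\<not> 2 \<le> j"
      then have "(j + 1) * (j + 2) \<le> 2 * 3" by (intro mult_mono) auto
      then show False using j False by linarith
    qed
    \<comment> \<open>With \<open>u = j + 1\<close> the first factor is at most
      \<open>exp (c / u)\<close>, and \<open>c / u \<le> j + 2\<close>.\<close>
    have "real (Q d a n) \<le> (1 + 1 / real (j + 1)) ^ c * exp (4 * real (j + 1))"
      using Q_le_exp[of a d n c "real (j + 1)"] a d lt_c by simp
    also have "\<dots> \<le> exp (real (j + 2)) * exp (4 * real (j + 1))"
    proof (rule mult_right_mono)
      have "(1 + 1 / real (j + 1)) ^ c \<le> exp (1 / real (j + 1)) ^ c"
        by (intro power_mono exp_ge_add_one_self) simp
      also have "\<dots> = exp (real c / real (j + 1))" by (simp flip: exp_of_nat_mult)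
      also have "real c / real (j + 1) \<le> real (j + 2)"
      proof -
        have "real c \<le> real ((j + 1) * (j + 2))" using j by (simp only: of_nat_le_iff)
        then have "real c \<le> real (j + 2) * real (j + 1)" by (simp only: of_nat_mult mult.commute)
        then show ?thesis by (rule pos_divide_le_eq[THEN iffD2, rotated]) simp
      qed
      then have "exp (real c / real (j + 1)) \<le> exp (real (j + 2))" by simp
      finally show "(1 + 1 / real (j + 1)) ^ c \<le> exp (real (j + 2))" .
    qed simp
    also have "\<dots> = exp (real (5 * j + 6))" by (simp flip: exp_add)
    also have "\<dots> \<le> exp (real (8 * j))" using j2 by simp
    \<comment> \<open>The estimate \<open>exp 8 \<le> 3 ^ 8 = 6561\<close> is where \<open>M = 6560\<close> comes from.\<close>
    also have "\<dots> \<le> 3 ^ (8 * j)" by (rule e1)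
    also have "\<dots> = real ((6560 + 1) ^ j)" by (simp add: power_mult)
    finally have "Q d a n \<le> (6560 + 1) ^ j" by (simp only: of_nat_le_iff)
    also have "\<dots> \<le> q d a n"
    proof (rule q_ge_power)
      have "(j * j + j + 1) * (d - a) \<le> c * (d + 3 - a)" using j by (intro mult_mono) auto
      then have "(j * j + j + 1) * (d - a) \<le> n" using c_le by linarith
      moreover have "int (d - a) = int d - int a" using d by simp
      ultimately have n_ge: "int (j * j + j + 1) * (int d - int a) \<le> int n"
        by (metis of_nat_le_iff of_nat_mult)
      \<comment> \<open>\<open>P\<close> is the coefficient of \<open>d\<close> left from
        \<open>2 * (j * j + j + 1)\<close> after paying for \<open>d * (j * (j + 1))\<close>. Of
        \<open>P * d\<close>, one thousandth covers the terms in \<open>a\<close> and the rest those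
        in \<open>M = 6560\<close>.\<close>
      define P where "P = int (j * j + j + 2)"
      have P: "0 \<le> P" by (simp add: P_def)
      have "1000 * (int a * int (2 * j * j + 4 * j + 4)) \<le> 1000 * (int a * (4 * P))"
        by (intro mult_left_mono) (auto simp: P_def)
      also have "\<dots> = P * (4000 * int a)" by simp
      also have "\<dots> \<le> P * int d" by (rule mult_left_mono[OF _ P]) (use a d in simp)
      finally have 1: "1000 * (int a * int (2 * j * j + 4 * j + 4)) \<le> P * int d" .
      have 2: "P * 12200000 \<le> P * (999 * int d)" by (rule mult_left_mono[OF _ P]) (use a d in simp)
      have 3: "6560 * int (j * (j + 3)) \<le> 12200 * P"
      proof -
        have "2 * int j \<le> int j * int j" using j2 by (intro mult_right_mono) auto
        moreover have "int (j * (j + 3)) = int j * int j + 3 * int j" by (simp add: algebra_simps)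
        moreover have "P = int j * int j + int j + 2" by (simp add: P_def)
        ultimately show ?thesis by linarith
      qed
      have "int (2 * (j + 1) * a + d * (j * (j + 1)) + 6560 * (j * (j + 3))) \<le> 2 * int n"
        using 1 2 3 n_ge unfolding P_def by (simp add: algebra_simps)
      then show "2 * (j + 1) * a + d * (j * (j + 1)) + 6560 * (j * (j + 3)) \<le> 2 * n"
        by linarith
    qed (use a d in auto)
    finally show ?thesis .
  qed
qed

section \<open>Comparison for \<open>c < 2\<close> and the exceptional values\<close>

lemma Q_le_q_small:
  assumes a: "3 \<le> a" and d: "4095 * a \<le> d" and n: "n < 2 * (d + 3 - a)"
    and exc: "a dvd d + 3 \<Longrightarrow> n \<noteq> d - a + 3 \<and> n \<noteq> d + 3 \<and> n \<noteq> d + a + 3"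
    "\<not> a dvd d + 3 \<Longrightarrow> a > 3 \<Longrightarrow> n \<noteq> d + a + 3"
  shows "Q d a n \<le> q d a n"
proof -
  define m where "m = d + 3"
  have m: "4 * a < m" using a d by (simp add: m_def)
  define R where "R = {r. set_mset r \<subseteq> big_parts m a \<and> sum_mset r \<le> n \<and> a dvd n - sum_mset r}"
  have Q_le: "Q d a n \<le> card R"
    using Q_le_card_big_parts[of a d n] a m by (simp add: R_def m_def)
  have R_sub: "R \<subseteq> {{#}, {#m - a#}, {#m + a#}}"
  proof
    fix r assume r: "r \<in> R"
    show "r \<in> {{#}, {#m - a#}, {#m + a#}}"
    proof (cases r)
      case (add b r')
      have r'_empty: "r' = {#}"
      proof (cases r')
        case (add b' r'')
        then have "m - a \<le> b" "m - a \<le> b'" "b + b' \<le> n"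
          using r \<open>r = add_mset b r'\<close> m by (auto simp: R_def intro: big_parts_ge)
        then show ?thesis using n by (simp add: m_def)
      qed
      then have b: "b \<in> big_parts m a" "b < 2 * (m - a)"
        using r add n by (auto simp: R_def m_def)
      then obtain i where i: "i \<ge> 1" "b + a = i * m \<or> b = i * m + a" by (auto simp: big_parts_def)
      have "i = 1"
      proof (rule ccontr)
        assume "i \<noteq> 1"
        then have "2 * m \<le> i * m" using i by (intro mult_right_mono) auto
        then show False using i b a by linarith
      qed
      then show ?thesis using i add r'_empty by auto
    qed simp
  qed
  show ?thesis
  \<comment> \<open>From this threshold on, two-part partitions with \<open>M = 1\<close> give
    \<open>q \<ge> 3\<close>. Below it, \<open>n < m + 2 * a - 1\<close>, which leaves few multiples
    of \<open>a\<close> for the remainders.\<close>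
  proof (cases "d + 2 * a + 2 \<le> n")
    case True
    have "card R \<le> card {{#}, {#m - a#}, {#m + a#}}" by (rule card_mono[OF _ R_sub]) simp
    also have "\<dots> \<le> 3" by (simp add: card_insert_if)
    also have "3 \<le> q d a n" using q_ge_two_parts[of a d 1 n] a d True by simp
    finally show ?thesis using Q_le by simp
  next
    case False
    \<comment> \<open>If both \<open>{#}\<close> and \<open>{#m - a#}\<close> occur, then
      \<open>a\<close> divides \<open>m\<close> and \<open>n - (m - a)\<close> is one of
      \<open>0\<close>, \<open>a\<close>, \<open>2 * a\<close>: exactly the three exceptions for
      \<open>a dvd d + 3\<close>.\<close>
    have m_dvd: False if "a dvd n" "m - a \<le> n" "a dvd n - (m - a)"
    proof -
      obtain t where t: "n - (m - a) = a * t" using \<open>a dvd n - (m - a)\<close> by blast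
      have "a dvd n - (n - (m - a))" using that by (intro dvd_diff_nat[OF that(1,3)])
      then have "a dvd m - a" using that by simp
      have "a dvd m" using m by (intro dvd_diffD[OF \<open>a dvd m - a\<close> dvd_refl]) simp
      have "n - (m - a) < 3 * a" using False m a by (simp add: m_def)
      then have "t < 3" unfolding t by simp
      then have "t = 0 \<or> t = 1 \<or> t = 2" by auto
      then have "n = m - a \<or> n = m \<or> n = m + a" using t that m by auto
      then show False using exc(1) \<open>a dvd m\<close> m by (auto simp: m_def)
    qed
    \<comment> \<open>The remainder \<open>n - (m + a)\<close> is below \<open>a\<close>, hence 0;
      the exceptions then leave only \<open>a = 3\<close>.\<close>
    have plus: "n = m + a \<and> a = 3" if "{#m + a#} \<in> R"
    proof -
      have "m + a \<le> n" "a dvd n - (m + a)" using that by (auto simp: R_def)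
      moreover have "n - (m + a) < a" using False a by (simp add: m_def)
      ultimately have "n = m + a" using nat_dvd_not_less by fastforce
      then show ?thesis using exc a by (cases "a dvd m"; cases "a = 3") (auto simp: m_def)
    qed
    consider "{#} \<in> R" | "{#} \<notin> R" "{#m + a#} \<in> R" | "R \<subseteq> {{#m - a#}}" using R_sub by blast
    then show ?thesis
    proof cases
      case 1
      then have "a dvd n" by (simp add: R_def)
      have "{#m - a#} \<notin> R" using m_dvd \<open>a dvd n\<close> by (auto simp: R_def)
      moreover have "{#m + a#} \<notin> R"
      proof
        assume "{#m + a#} \<in> R"
        then have "n = m + a" using plus by blast
        then have "n - (m - a) = 2 * a" "m - a \<le> n" using m by auto
        then show False using m_dvd \<open>a dvd n\<close> by simp
      qed
      ultimately have "R \<subseteq> {{#}}" using R_sub by blast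
      then have "card R \<le> 1" using card_mono[of "{{#}}" R] by simp
      moreover have "1 \<le> q d a n"
      proof (rule q_pos)
        show "n = 0 \<or> a \<le> n" using \<open>a dvd n\<close> by (auto intro: dvd_imp_le)
      qed (use a in simp)
      ultimately show ?thesis using Q_le by simp
    next
      case 2
      then have "R \<subseteq> {{#m - a#}, {#m + a#}}" using R_sub by blast
      then have "card R \<le> card {{#m - a#}, {#m + a#}}" by (intro card_mono) auto
      also have "\<dots> \<le> 2" by (simp add: card_insert_if)
      \<comment> \<open>Here \<open>a = 3\<close> gives \<open>n = d + 6 = d + 2 * a\<close>, just
        enough for one two-part partition; for \<open>a > 3\<close>, \<open>d + a + 3\<close> would
        fall short.\<close>
      also have "2 \<le> q d a n"
        using q_ge_two_parts[of a d 0 n] plus[OF 2(2)] a d by (simp add: m_def)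
      finally show ?thesis using Q_le by simp
    next
      case 3
      show ?thesis
      proof (cases "R = {}")
        case False
        then have "m - a \<le> n" using 3 by (auto simp: R_def)
        then have "1 \<le> q d a n" using a m by (intro q_pos) auto
        then show ?thesis using Q_le card_mono[OF _ 3] by simp
      qed (use Q_le in simp)
    qed
  qed
qed

theorem theorem1p2:
  fixes a d n :: nat
  assumes "a \<ge> 3"
    and "d \<ge> a * (2 ^ 12 - 1)"
    and "a dvd d + 3 \<Longrightarrow> n \<noteq> d - a + 3 \<and> n \<noteq> d + 3 \<and> n \<noteq> d + a + 3"
    and "\<not> a dvd d + 3 \<Longrightarrow> a > 3 \<Longrightarrow> n \<noteq> d + a + 3"
  shows "q d a n \<ge> Q d a n"
proof (cases "n < 2 * (d + 3 - a)")
  case True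
  then show ?thesis using assms by (intro Q_le_q_small) (auto simp: mult.commute)
next
  case False
  then show ?thesis using assms by (intro Q_le_q_of_2_le_div) (auto simp: mult.commute)
qed

end
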